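(* Let $M$ be a non-zero left $R$-module which is an S-IAD-module. Then $M$ is uniform if and only if $\mathrm{Spec}^{\mathrm{fc}}(M)$ is ultraconnected.
   Context: $R$ is an associative (not necessarily commutative) ring with $1_R\neq 0_R$ and modules are unital left $R$-modules; $L\leq_R M$ means that $L$ is an $R$-submodule of $M$. A submodule $L\leq_R M$ is fully invariant if $f(L)\subseteq L$ for every $R$-linear endomorphism $f$ of $M$; $M$ is duo if every $R$-submodule of $M$ is fully invariant. $M$ is self-injective if for every $N\leq_R M$ every $R$-linear map $N\to M$ extends to an endomorphism of $M$. $M$ is atomic if every non-zero submodule of $M$ contains a simple submodule. An S-IAD-module is a module that is self-injective, atomic and duo. $M$ is uniform if $L_1\cap L_2\neq 0$ for all non-zero submodules $L_1,L_2$ of $M$. For $X,Y\leq_R M$ put $\mathrm{An}(X)=\{f\in \mathrm{End}_R(M)\mid f(X)=0\}$ and $X\odot_M Y=\bigcap_{f\in\mathrm{An}(X)} f^{-1}(Y)$. A non-zero fully invariant submodule $K$ of $M$ is fully coprime in $M$ if for all fully invariant submodules $X,Y$ of $M$: $K\subseteq X\odot_M Y$ implies $K\subseteq X$ or $K\subseteq Y$. $\mathrm{Spec}^{\mathrm{fc}}(M)$ is the set of all non-zero fully invariant submodules of $M$ that are fully coprime in $M$. For $M$ duo, $\mathrm{Spec}^{\mathrm{fc}}(M)$ carries the topology whose closed sets are $\mathcal{V}^{\mathrm{fc}}(L)=\{K\in\mathrm{Spec}^{\mathrm{fc}}(M)\mid K\subseteq L\}$, $L\leq_R M$. A non-empty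 topological space is ultraconnected if the intersection of any two non-empty closed subsets is non-empty. *)

theory Defs
  imports "HOL-Algebra.Module" "HOL-Analysis.Abstract_Topology"
begin

text \<open>
  The locale \<open>module\<close> of HOL-Algebra requires a commutative ring of scalars. The following
  locale has the same axioms over an arbitrary unital ring; the record type \<open>module\<close> and
  the locale \<open>submodule\<close>, which do not depend on commutativity, are reused.
\<close>

locale left_module = R?: ring R + M?: abelian_group M
  for R :: "('r, 'c) ring_scheme" (structure) and M :: "('r, 'm, 'd) module_scheme" (structure) +
  assumes smult_closed [simp, intro]:
      "\<lbrakk>a \<in> carrier R; x \<in> carrier M\<rbrakk> \<Longrightarrow> a \<odot>\<^bsub>M\<^esub> x \<in> carrier M"
    and smult_l_distr:
      "\<lbrakk>a \<in> carrier R; b \<in> carrier R; x \<in> carrier M\<rbrakk> \<Longrightarrow>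
        (a \<oplus> b) \<odot>\<^bsub>M\<^esub> x = a \<odot>\<^bsub>M\<^esub> x \<oplus>\<^bsub>M\<^esub> b \<odot>\<^bsub>M\<^esub> x"
    and smult_r_distr:
      "\<lbrakk>a \<in> carrier R; x \<in> carrier M; y \<in> carrier M\<rbrakk> \<Longrightarrow>
        a \<odot>\<^bsub>M\<^esub> (x \<oplus>\<^bsub>M\<^esub> y) = a \<odot>\<^bsub>M\<^esub> x \<oplus>\<^bsub>M\<^esub> a \<odot>\<^bsub>M\<^esub> y"
    and smult_assoc1:
      "\<lbrakk>a \<in> carrier R; b \<in> carrier R; x \<in> carrier M\<rbrakk> \<Longrightarrow>
        (a \<otimes> b) \<odot>\<^bsub>M\<^esub> x = a \<odot>\<^bsub>M\<^esub> (b \<odot>\<^bsub>M\<^esub> x)"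
    and smult_one [simp]:
      "x \<in> carrier M \<Longrightarrow> \<one> \<odot>\<^bsub>M\<^esub> x = x"

text \<open>
  Linear maps are represented by total HOL functions; their values outside the domain are
  arbitrary and are never used below.
\<close>

definition linear_maps ::
  "('r, 'c) ring_scheme \<Rightarrow> ('r, 'm, 'd) module_scheme \<Rightarrow> 'm set \<Rightarrow> ('m \<Rightarrow> 'm) set" where
  "linear_maps R M N = {f. f \<in> N \<rightarrow> carrier M \<and>
     (\<forall>x\<in>N. \<forall>y\<in>N. f (x \<oplus>\<^bsub>M\<^esub> y) = f x \<oplus>\<^bsub>M\<^esub> f y) \<and>
     (\<forall>a\<in>carrier R. \<forall>x\<in>N. f (a \<odot>\<^bsub>M\<^esub> x) = a \<odot>\<^bsub>M\<^esub> f x)}"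

definition End ::
  "('r, 'c) ring_scheme \<Rightarrow> ('r, 'm, 'd) module_scheme \<Rightarrow> ('m \<Rightarrow> 'm) set" where
  "End R M = linear_maps R M (carrier M)"

definition fully_invariant ::
  "('r, 'c) ring_scheme \<Rightarrow> ('r, 'm, 'd) module_scheme \<Rightarrow> 'm set \<Rightarrow> bool" where
  "fully_invariant R M L \<longleftrightarrow> submodule L R M \<and> (\<forall>f\<in>End R M. f ` L \<subseteq> L)"

definition duo :: "('r, 'c) ring_scheme \<Rightarrow> ('r, 'm, 'd) module_scheme \<Rightarrow> bool" where
  "duo R M \<longleftrightarrow> (\<forall>L. submodule L R M \<longrightarrow> fully_invariant R M L)"

definition self_injective :: "('r, 'c) ring_scheme \<Rightarrow> ('r, 'm, 'd) module_scheme \<Rightarrow> bool" where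
  "self_injective R M \<longleftrightarrow>
     (\<forall>N. submodule N R M \<longrightarrow> (\<forall>f\<in>linear_maps R M N. \<exists>g\<in>End R M. \<forall>x\<in>N. g x = f x))"

definition simple_submodule ::
  "('r, 'c) ring_scheme \<Rightarrow> ('r, 'm, 'd) module_scheme \<Rightarrow> 'm set \<Rightarrow> bool" where
  "simple_submodule R M S \<longleftrightarrow> submodule S R M \<and> S \<noteq> {\<zero>\<^bsub>M\<^esub>} \<and>
     (\<forall>T. submodule T R M \<and> T \<subseteq> S \<longrightarrow> T = {\<zero>\<^bsub>M\<^esub>} \<or> T = S)"

definition atomic :: "('r, 'c) ring_scheme \<Rightarrow> ('r, 'm, 'd) module_scheme \<Rightarrow> bool" where
  "atomic R M \<longleftrightarrow>
     (\<forall>L. submodule L R M \<and> L \<noteq> {\<zero>\<^bsub>M\<^esub>} \<longrightarrow> (\<exists>S. simple_submodule R M S \<and> S \<subseteq> L))"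

definition S_IAD_module :: "('r, 'c) ring_scheme \<Rightarrow> ('r, 'm, 'd) module_scheme \<Rightarrow> bool" where
  "S_IAD_module R M \<longleftrightarrow> left_module R M \<and> self_injective R M \<and> atomic R M \<and> duo R M"

definition uniform :: "('r, 'c) ring_scheme \<Rightarrow> ('r, 'm, 'd) module_scheme \<Rightarrow> bool" where
  "uniform R M \<longleftrightarrow> (\<forall>L1 L2. submodule L1 R M \<and> L1 \<noteq> {\<zero>\<^bsub>M\<^esub>} \<and>
     submodule L2 R M \<and> L2 \<noteq> {\<zero>\<^bsub>M\<^esub>} \<longrightarrow> L1 \<inter> L2 \<noteq> {\<zero>\<^bsub>M\<^esub>})"

definition An ::
  "('r, 'c) ring_scheme \<Rightarrow> ('r, 'm, 'd) module_scheme \<Rightarrow> 'm set \<Rightarrow> ('m \<Rightarrow> 'm) set" where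
  "An R M X = {f \<in> End R M. \<forall>x\<in>X. f x = \<zero>\<^bsub>M\<^esub>}"

definition coproduct ::
  "('r, 'c) ring_scheme \<Rightarrow> ('r, 'm, 'd) module_scheme \<Rightarrow> 'm set \<Rightarrow> 'm set \<Rightarrow> 'm set" where
  "coproduct R M X Y = (\<Inter>f\<in>An R M X. {x \<in> carrier M. f x \<in> Y})"

definition fully_coprime ::
  "('r, 'c) ring_scheme \<Rightarrow> ('r, 'm, 'd) module_scheme \<Rightarrow> 'm set \<Rightarrow> bool" where
  "fully_coprime R M K \<longleftrightarrow> fully_invariant R M K \<and> K \<noteq> {\<zero>\<^bsub>M\<^esub>} \<and>
     (\<forall>X Y. fully_invariant R M X \<and> fully_invariant R M Y \<and> K \<subseteq> coproduct R M X Y \<longrightarrow>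
        K \<subseteq> X \<or> K \<subseteq> Y)"

definition Spec_fc ::
  "('r, 'c) ring_scheme \<Rightarrow> ('r, 'm, 'd) module_scheme \<Rightarrow> 'm set set" where
  "Spec_fc R M = {K. fully_coprime R M K}"

definition V_fc ::
  "('r, 'c) ring_scheme \<Rightarrow> ('r, 'm, 'd) module_scheme \<Rightarrow> 'm set \<Rightarrow> 'm set set" where
  "V_fc R M L = {K \<in> Spec_fc R M. K \<subseteq> L}"

text \<open>
  The sets below form a topology only under additional assumptions such as \<open>duo R M\<close>; see
  \<open>closedin_Spec_fc_topology\<close>.
\<close>

definition Spec_fc_topology ::
  "('r, 'c) ring_scheme \<Rightarrow> ('r, 'm, 'd) module_scheme \<Rightarrow> 'm set topology" where
  "Spec_fc_topology R M =
     topology (\<lambda>U. \<exists>L. submodule L R M \<and> U = Spec_fc R M - V_fc R M L)"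

definition ultraconnected_space :: "'a topology \<Rightarrow> bool" where
  "ultraconnected_space T \<longleftrightarrow> topspace T \<noteq> {} \<and>
     (\<forall>C D. closedin T C \<and> closedin T D \<and> C \<noteq> {} \<and> D \<noteq> {} \<longrightarrow> C \<inter> D \<noteq> {})"


lemma V_fc_subset: "V_fc R M L \<subseteq> Spec_fc R M"
  by (auto simp: V_fc_def)

lemma in_Spec_fcD:
  assumes "K \<in> Spec_fc R M"
  shows "submodule K R M" "K \<noteq> {\<zero>\<^bsub>M\<^esub>}"
  using assms unfolding Spec_fc_def fully_coprime_def fully_invariant_def by blast+

context left_module
begin

lemma smult_r_null: "a \<in> carrier R \<Longrightarrow> a \<odot>\<^bsub>M\<^esub> \<zero>\<^bsub>M\<^esub> = \<zero>\<^bsub>M\<^esub>"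
  by (metis M.add.r_cancel_one' M.l_zero M.zero_closed smult_closed smult_r_distr)

lemma submodule_subset: "submodule L R M \<Longrightarrow> L \<subseteq> carrier M"
  using subgroup.subset[of L "add_monoid M"] by (auto simp: submodule_def)

lemma submodule_zero: "submodule L R M \<Longrightarrow> \<zero>\<^bsub>M\<^esub> \<in> L"
  using subgroup.one_closed[of L "add_monoid M"] by (auto simp: submodule_def)

lemma submodule_add: "submodule L R M \<Longrightarrow> x \<in> L \<Longrightarrow> y \<in> L \<Longrightarrow> x \<oplus>\<^bsub>M\<^esub> y \<in> L"
  using subgroup.m_closed[of L "add_monoid M"] by (auto simp: submodule_def)

lemma submodule_minus: "submodule L R M \<Longrightarrow> x \<in> L \<Longrightarrow> \<ominus>\<^bsub>M\<^esub> x \<in> L"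
  using subgroup.m_inv_closed[of L "add_monoid M"] by (auto simp: submodule_def a_inv_def)

lemma submodule_smult: "submodule L R M \<Longrightarrow> a \<in> carrier R \<Longrightarrow> x \<in> L \<Longrightarrow> a \<odot>\<^bsub>M\<^esub> x \<in> L"
  by (rule submodule.smult_closed)

lemma submoduleI:
  assumes "L \<subseteq> carrier M" "\<zero>\<^bsub>M\<^esub> \<in> L" "\<And>x. x \<in> L \<Longrightarrow> \<ominus>\<^bsub>M\<^esub> x \<in> L"
    "\<And>x y. x \<in> L \<Longrightarrow> y \<in> L \<Longrightarrow> x \<oplus>\<^bsub>M\<^esub> y \<in> L"
    "\<And>a x. a \<in> carrier R \<Longrightarrow> x \<in> L \<Longrightarrow> a \<odot>\<^bsub>M\<^esub> x \<in> L"
  shows "submodule L R M"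
  using assms by (intro submodule.intro subgroup.intro submodule_axioms.intro)
    (auto simp: a_inv_def)

lemma carrier_submodule: "submodule (carrier M) R M"
  by (rule submoduleI) auto

lemma zero_submodule: "submodule {\<zero>\<^bsub>M\<^esub>} R M"
  by (rule submoduleI) (auto simp: smult_r_null)

lemma End_closed: "f \<in> End R M \<Longrightarrow> x \<in> carrier M \<Longrightarrow> f x \<in> carrier M"
  by (auto simp: End_def linear_maps_def)

lemma End_group_hom: "f \<in> End R M \<Longrightarrow> group_hom (add_monoid M) (add_monoid M) f"
  by (unfold_locales) (auto simp: End_def linear_maps_def hom_def)

lemma End_zero: "f \<in> End R M \<Longrightarrow> f \<zero>\<^bsub>M\<^esub> = \<zero>\<^bsub>M\<^esub>"
  using group_hom.hom_one[OF End_group_hom] by simp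

lemma End_minus: "f \<in> End R M \<Longrightarrow> x \<in> carrier M \<Longrightarrow> f (\<ominus>\<^bsub>M\<^esub> x) = \<ominus>\<^bsub>M\<^esub> f x"
  using group_hom.hom_inv[OF End_group_hom, of f x] by (simp add: a_inv_def)

lemma coproduct_submodule:
  assumes Y: "submodule Y R M"
  shows "submodule (coproduct R M X Y) R M"
proof -
  have "(\<lambda>_. \<zero>\<^bsub>M\<^esub>) \<in> An R M X"
    by (auto simp: An_def End_def linear_maps_def smult_r_null)
  then have sub: "coproduct R M X Y \<subseteq> carrier M"
    unfolding coproduct_def by blast
  have mem: "x \<in> coproduct R M X Y \<longleftrightarrow> x \<in> carrier M \<and> (\<forall>f\<in>An R M X. f x \<in> Y)" for x
    using sub unfolding coproduct_def by blast
  have E: "f \<in> End R M" if "f \<in> An R M X" for f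
    using that by (simp add: An_def)
  have add: "f (x \<oplus>\<^bsub>M\<^esub> y) = f x \<oplus>\<^bsub>M\<^esub> f y"
    if "f \<in> An R M X" "x \<in> carrier M" "y \<in> carrier M" for f x y
    using E[OF that(1)] that(2,3) unfolding End_def linear_maps_def by blast
  have smult: "f (a \<odot>\<^bsub>M\<^esub> x) = a \<odot>\<^bsub>M\<^esub> f x"
    if "f \<in> An R M X" "a \<in> carrier R" "x \<in> carrier M" for f a x
    using E[OF that(1)] that(2,3) unfolding End_def linear_maps_def by blast
  show ?thesis
  proof (rule submoduleI)
    show "coproduct R M X Y \<subseteq> carrier M" by (rule sub)
    have "f \<zero>\<^bsub>M\<^esub> \<in> Y" if "f \<in> An R M X" for f
      unfolding End_zero[OF E[OF that]] by (rule submodule_zero[OF Y])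
    then show "\<zero>\<^bsub>M\<^esub> \<in> coproduct R M X Y"
      unfolding mem by blast
  next
    fix x assume x: "x \<in> coproduct R M X Y"
    then have xM: "x \<in> carrier M" and xY: "\<And>f. f \<in> An R M X \<Longrightarrow> f x \<in> Y"
      unfolding mem by blast+
    have "f (\<ominus>\<^bsub>M\<^esub> x) \<in> Y" if "f \<in> An R M X" for f
      unfolding End_minus[OF E[OF that] xM] by (rule submodule_minus[OF Y xY[OF that]])
    then show "\<ominus>\<^bsub>M\<^esub> x \<in> coproduct R M X Y"
      unfolding mem using M.a_inv_closed[OF xM] by blast
    show "a \<odot>\<^bsub>M\<^esub> x \<in> coproduct R M X Y" if a: "a \<in> carrier R" for a
    proof -
      have "f (a \<odot>\<^bsub>M\<^esub> x) \<in> Y" if "f \<in> An R M X" for f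
        unfolding smult[OF that a xM] by (rule submodule_smult[OF Y a xY[OF that]])
      then show ?thesis
        unfolding mem using smult_closed[OF a xM] by blast
    qed
    show "x \<oplus>\<^bsub>M\<^esub> y \<in> coproduct R M X Y" if y: "y \<in> coproduct R M X Y" for y
    proof -
      have yM: "y \<in> carrier M" and yY: "\<And>f. f \<in> An R M X \<Longrightarrow> f y \<in> Y"
        using y unfolding mem by blast+
      have "f (x \<oplus>\<^bsub>M\<^esub> y) \<in> Y" if "f \<in> An R M X" for f
        unfolding add[OF that xM yM] by (rule submodule_add[OF Y xY[OF that] yY[OF that]])
      then show ?thesis
        unfolding mem using M.a_closed[OF xM yM] by blast
    qed
  qed
qed

lemma V_fc_Un:
  assumes "duo R M" and X: "submodule X R M" and Y: "submodule Y R M"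
  shows "V_fc R M X \<union> V_fc R M Y = V_fc R M (coproduct R M X Y)"
proof -
  have fi: "fully_invariant R M X" "fully_invariant R M Y"
    using assms by (auto simp: duo_def)
  have "X \<subseteq> coproduct R M X Y"
    using submodule_subset[OF X] submodule_zero[OF Y] unfolding coproduct_def An_def by fastforce
  moreover have "Y \<subseteq> coproduct R M X Y"
    using submodule_subset[OF Y] fi(2) unfolding coproduct_def An_def fully_invariant_def by blast
  moreover have "K \<subseteq> X \<or> K \<subseteq> Y" if "K \<in> Spec_fc R M" "K \<subseteq> coproduct R M X Y" for K
    using that fi unfolding Spec_fc_def fully_coprime_def by blast
  ultimately show ?thesis
    unfolding V_fc_def by blast
qed

lemma istopology_Spec_fc:
  assumes "duo R M"
  shows "istopology (\<lambda>U. \<exists>L. submodule L R M \<and> U = Spec_fc R M - V_fc R M L)"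
  unfolding istopology_def
proof (intro conjI allI impI)
  fix S T
  assume "\<exists>L. submodule L R M \<and> S = Spec_fc R M - V_fc R M L"
    and "\<exists>L. submodule L R M \<and> T = Spec_fc R M - V_fc R M L"
  then obtain X Y where X: "submodule X R M" "S = Spec_fc R M - V_fc R M X"
    and Y: "submodule Y R M" "T = Spec_fc R M - V_fc R M Y" by blast
  have "S \<inter> T = Spec_fc R M - V_fc R M (coproduct R M X Y)"
    using V_fc_Un[OF assms X(1) Y(1)] X(2) Y(2) by blast
  then show "\<exists>L. submodule L R M \<and> S \<inter> T = Spec_fc R M - V_fc R M L"
    using coproduct_submodule[OF Y(1)] by blast
next
  fix \<K>
  assume \<K>: "\<forall>K\<in>\<K>. \<exists>L. submodule L R M \<and> K = Spec_fc R M - V_fc R M L"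
  define \<L> where "\<L> = {L. submodule L R M \<and> Spec_fc R M - V_fc R M L \<in> \<K>}"
  define N where "N = carrier M \<inter> \<Inter>\<L>"
  have "submodule N R M"
  proof (rule submoduleI)
    have sub: "submodule L R M" if "L \<in> \<L>" for L
      using that unfolding \<L>_def by blast
    show "N \<subseteq> carrier M" unfolding N_def by blast
    show "\<zero>\<^bsub>M\<^esub> \<in> N"
      using submodule_zero[OF sub] unfolding N_def by simp
    show "\<ominus>\<^bsub>M\<^esub> x \<in> N" if "x \<in> N" for x
      using that submodule_minus[OF sub] unfolding N_def by simp
    show "x \<oplus>\<^bsub>M\<^esub> y \<in> N" if "x \<in> N" "y \<in> N" for x y
      using that submodule_add[OF sub] unfolding N_def by simp
    show "a \<odot>\<^bsub>M\<^esub> x \<in> N" if "a \<in> carrier R" "x \<in> N" for a x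
      using that submodule_smult[OF sub] unfolding N_def by simp
  qed
  moreover have "\<Union>\<K> = Spec_fc R M - V_fc R M N"
  proof (rule Set.set_eqI)
    fix K
    have "K \<in> \<Union>\<K> \<longleftrightarrow> (\<exists>L\<in>\<L>. K \<in> Spec_fc R M - V_fc R M L)"
    proof
      assume "K \<in> \<Union>\<K>"
      then obtain U where U: "U \<in> \<K>" "K \<in> U" by (rule UnionE)
      with \<K> obtain L where "submodule L R M" "U = Spec_fc R M - V_fc R M L"
        by meson
      with U show "\<exists>L\<in>\<L>. K \<in> Spec_fc R M - V_fc R M L"
        unfolding \<L>_def by (intro bexI[of _ L]) simp_all
    next
      assume "\<exists>L\<in>\<L>. K \<in> Spec_fc R M - V_fc R M L"
      then obtain L where "L \<in> \<L>" "K \<in> Spec_fc R M - V_fc R M L" by (rule bexE)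
      then show "K \<in> \<Union>\<K>"
        unfolding \<L>_def by (intro UnionI[of "Spec_fc R M - V_fc R M L"]) simp_all
    qed
    also have "\<dots> \<longleftrightarrow> K \<in> Spec_fc R M \<and> \<not> K \<subseteq> \<Inter>\<L>"
      unfolding V_fc_def by blast
    also have "\<dots> \<longleftrightarrow> K \<in> Spec_fc R M - V_fc R M N"
      using submodule_subset[OF in_Spec_fcD(1)[of K R M]] unfolding V_fc_def N_def by auto
    finally show "K \<in> \<Union>\<K> \<longleftrightarrow> K \<in> Spec_fc R M - V_fc R M N" .
  qed
  ultimately show "\<exists>L. submodule L R M \<and> \<Union>\<K> = Spec_fc R M - V_fc R M L"
    by blast
qed

lemma openin_Spec_fc_topology:
  assumes "duo R M"
  shows "openin (Spec_fc_topology R M) U \<longleftrightarrow>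
    (\<exists>L. submodule L R M \<and> U = Spec_fc R M - V_fc R M L)"
  unfolding Spec_fc_topology_def topology_inverse'[OF istopology_Spec_fc[OF assms]] ..

lemma topspace_Spec_fc_topology:
  assumes "duo R M"
  shows "topspace (Spec_fc_topology R M) = Spec_fc R M"
proof (rule subset_antisym)
  show "topspace (Spec_fc_topology R M) \<subseteq> Spec_fc R M"
    using openin_topspace[of "Spec_fc_topology R M"]
    unfolding openin_Spec_fc_topology[OF assms] by blast
  have "V_fc R M {\<zero>\<^bsub>M\<^esub>} = {}"
    using in_Spec_fcD[of _ R M] submodule_zero unfolding V_fc_def by blast
  then have "openin (Spec_fc_topology R M) (Spec_fc R M)"
    unfolding openin_Spec_fc_topology[OF assms] using zero_submodule by (metis Diff_empty)
  then show "Spec_fc R M \<subseteq> topspace (Spec_fc_topology R M)"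
    by (rule openin_subset)
qed

lemma closedin_Spec_fc_topology:
  assumes "duo R M"
  shows "closedin (Spec_fc_topology R M) C \<longleftrightarrow> (\<exists>L. submodule L R M \<and> C = V_fc R M L)"
  unfolding closedin_def topspace_Spec_fc_topology[OF assms]
    openin_Spec_fc_topology[OF assms]
  using V_fc_subset[of R M] by blast

end

end

theory Submission
  imports Defs
begin

text \<open>
  The simple submodules are what makes the spectrum large enough to see all non-zero submodules.
  If \<open>M\<close> is self-injective, a fully invariant simple submodule \<open>S\<close> is fully coprime
  (\<open>fully_coprime_simple\<close>): if \<open>S\<close> is not contained in \<open>X\<close>, then \<open>S \<inter> X = 0\<close>, so the projection
  \<open>X \<oplus> S \<rightarrow> S\<close> extends to an endomorphism \<open>f\<close> of \<open>M\<close> (\<open>extend_projection\<close>). This \<open>f\<close> kills \<open>X\<close>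
  and fixes \<open>S\<close> pointwise, so \<open>S \<subseteq> coproduct R M X Y\<close> gives \<open>S = f(S) \<subseteq> Y\<close>.

  In an S-IAD-module every non-zero submodule therefore contains a simple, hence a fully coprime,
  submodule. So for a submodule \<open>L\<close> the closed set \<open>V(L)\<close> is non-empty exactly when
  \<open>L \<noteq> 0\<close> (\<open>V_fc_nonempty_iff\<close>). As \<open>V(L) \<inter> V(N) = V(L \<inter> N)\<close>, two non-empty closed sets
  meet exactly when the corresponding submodules do.
\<close>

lemma V_fc_Int: "V_fc R M L \<inter> V_fc R M N = V_fc R M (L \<inter> N)"
  by (auto simp: V_fc_def)

context left_module
begin

lemma submodule_Int:
  assumes "submodule L R M" "submodule N R M"
  shows "submodule (L \<inter> N) R M"
  using submodule_subset[OF assms(1)] assms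
  by (intro submoduleI)
    (auto intro: submodule_zero submodule_minus submodule_add submodule_smult)

lemma direct_sum_unique:
  assumes X: "submodule X R M" and S: "submodule S R M" and int: "X \<inter> S = {\<zero>\<^bsub>M\<^esub>}"
    and x: "x \<in> X" "x' \<in> X" and s: "s \<in> S" "s' \<in> S"
    and eq: "x \<oplus>\<^bsub>M\<^esub> s = x' \<oplus>\<^bsub>M\<^esub> s'"
  shows "s = s'"
proof -
  have c: "x \<in> carrier M" "x' \<in> carrier M" "s \<in> carrier M" "s' \<in> carrier M"
    using x s submodule_subset[OF X] submodule_subset[OF S] by auto
  have "\<ominus>\<^bsub>M\<^esub> x' \<oplus>\<^bsub>M\<^esub> x = \<ominus>\<^bsub>M\<^esub> x' \<oplus>\<^bsub>M\<^esub> ((x \<oplus>\<^bsub>M\<^esub> s) \<oplus>\<^bsub>M\<^esub> \<ominus>\<^bsub>M\<^esub> s)"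
    using c by (simp add: M.a_assoc M.r_neg)
  also have "\<dots> = s' \<oplus>\<^bsub>M\<^esub> \<ominus>\<^bsub>M\<^esub> s"
    unfolding eq using c by (simp add: M.a_assoc M.r_neg1)
  finally have *: "\<ominus>\<^bsub>M\<^esub> x' \<oplus>\<^bsub>M\<^esub> x = s' \<oplus>\<^bsub>M\<^esub> \<ominus>\<^bsub>M\<^esub> s" .
  have "\<ominus>\<^bsub>M\<^esub> x' \<oplus>\<^bsub>M\<^esub> x \<in> X"
    by (intro submodule_add[OF X] submodule_minus[OF X] x)
  moreover have "s' \<oplus>\<^bsub>M\<^esub> \<ominus>\<^bsub>M\<^esub> s \<in> S"
    by (intro submodule_add[OF S] submodule_minus[OF S] s)
  ultimately have "s' \<oplus>\<^bsub>M\<^esub> \<ominus>\<^bsub>M\<^esub> s = \<zero>\<^bsub>M\<^esub>"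
    using int unfolding * by blast
  then show ?thesis
    using c by (metis M.minus_equality M.minus_minus M.a_inv_closed)
qed

text \<open>
  Self-injectivity produces endomorphisms that separate independent submodules: the projection
  along \<open>X\<close> is linear on the direct sum of \<open>X\<close> and \<open>S\<close>, and an extension of it to \<open>M\<close> has the
  stated properties.
\<close>

lemma extend_projection:
  assumes "self_injective R M" and X: "submodule X R M" and S: "submodule S R M"
    and int: "X \<inter> S = {\<zero>\<^bsub>M\<^esub>}"
  obtains f where "f \<in> An R M X" "\<And>s. s \<in> S \<Longrightarrow> f s = s"
proof -
  define N where "N = {x \<oplus>\<^bsub>M\<^esub> s | x s. x \<in> X \<and> s \<in> S}"
  define p where "p z = (THE s. s \<in> S \<and> (\<exists>x\<in>X. z = x \<oplus>\<^bsub>M\<^esub> s))" for z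
  have XM: "x \<in> carrier M" if "x \<in> X" for x using that submodule_subset[OF X] by blast
  have SM: "s \<in> carrier M" if "s \<in> S" for s using that submodule_subset[OF S] by blast
  have p: "p (x \<oplus>\<^bsub>M\<^esub> s) = s" if "x \<in> X" "s \<in> S" for x s
    unfolding p_def using that direct_sum_unique[OF X S int] by (intro the_equality) blast+
  have N_I: "x \<oplus>\<^bsub>M\<^esub> s \<in> N" if "x \<in> X" "s \<in> S" for x s
    using that unfolding N_def by blast
  have N_E: "\<exists>x\<in>X. \<exists>s\<in>S. z = x \<oplus>\<^bsub>M\<^esub> s" if "z \<in> N" for z
    using that unfolding N_def by blast
  have add: "(x \<oplus>\<^bsub>M\<^esub> s) \<oplus>\<^bsub>M\<^esub> (y \<oplus>\<^bsub>M\<^esub> t) = (x \<oplus>\<^bsub>M\<^esub> y) \<oplus>\<^bsub>M\<^esub> (s \<oplus>\<^bsub>M\<^esub> t)"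
    if "x \<in> X" "s \<in> S" "y \<in> X" "t \<in> S" for x s y t
    using that by (simp add: XM SM M.a_ac)
  have smult: "a \<odot>\<^bsub>M\<^esub> (x \<oplus>\<^bsub>M\<^esub> s) = a \<odot>\<^bsub>M\<^esub> x \<oplus>\<^bsub>M\<^esub> a \<odot>\<^bsub>M\<^esub> s"
    if "a \<in> carrier R" "x \<in> X" "s \<in> S" for a x s
    using that by (simp add: XM SM smult_r_distr)
  have minus: "\<ominus>\<^bsub>M\<^esub> (x \<oplus>\<^bsub>M\<^esub> s) = \<ominus>\<^bsub>M\<^esub> x \<oplus>\<^bsub>M\<^esub> \<ominus>\<^bsub>M\<^esub> s" if "x \<in> X" "s \<in> S" for x s
    using that by (simp add: XM SM M.minus_add)
  have N: "submodule N R M"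
  proof (rule submoduleI)
    show "N \<subseteq> carrier M"
      using XM SM unfolding N_def by blast
    show "\<zero>\<^bsub>M\<^esub> \<in> N"
      using N_I[OF submodule_zero[OF X] submodule_zero[OF S]] by simp
    show "\<ominus>\<^bsub>M\<^esub> z \<in> N" if "z \<in> N" for z
      using N_E[OF that] minus N_I submodule_minus[OF X] submodule_minus[OF S] by metis
    show "z \<oplus>\<^bsub>M\<^esub> w \<in> N" if "z \<in> N" "w \<in> N" for z w
      using N_E[OF that(1)] N_E[OF that(2)] add N_I submodule_add[OF X] submodule_add[OF S]
      by metis
    show "a \<odot>\<^bsub>M\<^esub> z \<in> N" if "a \<in> carrier R" "z \<in> N" for a z
      using N_E[OF that(2)] that(1) smult N_I submodule_smult[OF X] submodule_smult[OF S]
      by metis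
  qed
  have "p \<in> linear_maps R M N"
    unfolding linear_maps_def
  proof (intro CollectI conjI ballI)
    show "p \<in> N \<rightarrow> carrier M"
      using N_E p SM by (metis Pi_I)
    show "p (z \<oplus>\<^bsub>M\<^esub> w) = p z \<oplus>\<^bsub>M\<^esub> p w" if "z \<in> N" "w \<in> N" for z w
      using N_E[OF that(1)] N_E[OF that(2)] add p submodule_add[OF X] submodule_add[OF S]
      by metis
    show "p (a \<odot>\<^bsub>M\<^esub> z) = a \<odot>\<^bsub>M\<^esub> p z" if "a \<in> carrier R" "z \<in> N" for a z
      using N_E[OF that(2)] that(1) smult p submodule_smult[OF X] submodule_smult[OF S]
      by metis
  qed
  then obtain f where f: "f \<in> End R M" "\<And>z. z \<in> N \<Longrightarrow> f z = p z"
    using assms(1) N unfolding self_injective_def by blast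
  show thesis
  proof (rule that)
    have "f x = \<zero>\<^bsub>M\<^esub>" if "x \<in> X" for x
      using f(2)[OF N_I] p that submodule_zero[OF S] XM by (metis M.r_zero)
    then show "f \<in> An R M X"
      using f(1) by (simp add: An_def)
    show "f s = s" if "s \<in> S" for s
      using f(2)[OF N_I] p that submodule_zero[OF X] SM by (metis M.l_zero)
  qed
qed

text \<open>
  By simplicity, \<open>S\<close> either lies in \<open>X\<close> or meets it in \<open>0\<close>; in the second case a map that kills
  \<open>X\<close> and fixes \<open>S\<close> is one of the maps defining the coproduct of \<open>X\<close> and \<open>Y\<close>, and it puts
  \<open>S\<close> inside \<open>Y\<close>.
\<close>

lemma fully_coprime_simple:
  assumes "self_injective R M" and simple: "simple_submodule R M S" and "fully_invariant R M S"
  shows "fully_coprime R M S"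
  unfolding fully_coprime_def
proof (intro conjI allI impI)
  show "fully_invariant R M S" by fact
  show "S \<noteq> {\<zero>\<^bsub>M\<^esub>}" using simple by (simp add: simple_submodule_def)
  have S: "submodule S R M" using simple by (simp add: simple_submodule_def)
  fix X Y
  assume *: "fully_invariant R M X \<and> fully_invariant R M Y \<and> S \<subseteq> coproduct R M X Y"
  then have X: "submodule X R M" by (simp add: fully_invariant_def)
  show "S \<subseteq> X \<or> S \<subseteq> Y"
  proof (rule disjCI)
    assume "\<not> S \<subseteq> Y"
    show "S \<subseteq> X"
    proof (rule ccontr)
      assume "\<not> S \<subseteq> X"
      then have "X \<inter> S = {\<zero>\<^bsub>M\<^esub>}"
        using simple submodule_Int[OF X S] unfolding simple_submodule_def by blast
      then obtain f where "f \<in> An R M X" "\<And>s. s \<in> S \<Longrightarrow> f s = s"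
        using extend_projection[OF assms(1) X S] by blast
      then have "S \<subseteq> Y"
        using * unfolding coproduct_def by fastforce
      with \<open>\<not> S \<subseteq> Y\<close> show False ..
    qed
  qed
qed

text \<open>
  Points of the spectrum are non-zero, which gives one direction; for the other, a simple
  submodule of \<open>L\<close> is itself a point of \<open>V(L)\<close>.
\<close>

lemma V_fc_nonempty_iff:
  assumes "self_injective R M" "atomic R M" "duo R M" and L: "submodule L R M"
  shows "V_fc R M L \<noteq> {} \<longleftrightarrow> L \<noteq> {\<zero>\<^bsub>M\<^esub>}"
proof
  assume "V_fc R M L \<noteq> {}"
  then obtain K where "K \<in> Spec_fc R M" "K \<subseteq> L" by (auto simp: V_fc_def)
  then show "L \<noteq> {\<zero>\<^bsub>M\<^esub>}"
    using in_Spec_fcD[of K R M] submodule_zero[of K] by blast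
next
  assume "L \<noteq> {\<zero>\<^bsub>M\<^esub>}"
  then obtain S where S: "simple_submodule R M S" "S \<subseteq> L"
    using assms(2) L unfolding atomic_def by blast
  then have "fully_invariant R M S"
    using assms(3) by (simp add: duo_def simple_submodule_def)
  with S have "S \<in> V_fc R M L"
    using fully_coprime_simple[OF assms(1)] by (simp add: V_fc_def Spec_fc_def)
  then show "V_fc R M L \<noteq> {}" by blast
qed

end

theorem proposition3p30:
  fixes R :: "('r, 'c) ring_scheme" and M :: "('r, 'm, 'd) module_scheme"
  assumes "left_module R M"
    and "\<one>\<^bsub>R\<^esub> \<noteq> \<zero>\<^bsub>R\<^esub>"
    and "carrier M \<noteq> {\<zero>\<^bsub>M\<^esub>}"
    and "S_IAD_module R M"
  shows "uniform R M \<longleftrightarrow> ultraconnected_space (Spec_fc_topology R M)"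
proof -
  interpret left_module R M by fact
  have duo: "duo R M"
    using assms(4) by (simp add: S_IAD_module_def)
  have nonempty: "V_fc R M L \<noteq> {} \<longleftrightarrow> L \<noteq> {\<zero>\<^bsub>M\<^esub>}" if "submodule L R M" for L
    using V_fc_nonempty_iff that assms(4) by (simp add: S_IAD_module_def)
  have "Spec_fc R M \<noteq> {}"
    using nonempty[OF carrier_submodule] assms(3) V_fc_subset[of R M "carrier M"] by blast
  then have "ultraconnected_space (Spec_fc_topology R M) \<longleftrightarrow>
      (\<forall>L N. submodule L R M \<and> submodule N R M \<and> V_fc R M L \<noteq> {} \<and> V_fc R M N \<noteq> {} \<longrightarrow>
        V_fc R M (L \<inter> N) \<noteq> {})"
    unfolding ultraconnected_space_def topspace_Spec_fc_topology[OF duo]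
      closedin_Spec_fc_topology[OF duo] V_fc_Int[symmetric] by blast
  also have "\<dots> \<longleftrightarrow> uniform R M"
    unfolding uniform_def using nonempty submodule_Int by meson
  finally show ?thesis ..
qed

end
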